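(* Let $D(2)=\{z\in\mathbb C:|z|<2\}$, let $\xi:D(2)\to\mathbb C\setminus\{0\}$ be holomorphic and suppose that $\xi$ is $p$-valent. Then the length of $\log\xi([-1,1])$ does not exceed $8\pi p^2$.
   Context: A holomorphic function is $p$-valent ($p\in\mathbb N$) if it takes every value at most $p$ times in its domain. Here $\log\xi$ denotes a univalued holomorphic branch on the simply connected domain $D(2)$, and length is Euclidean length in $\mathbb C$. *)

theory Defs
  imports "HOL-Complex_Analysis.Complex_Analysis"
begin

(* The library has no notion of length of a curve; this is the usual supremum of the
   lengths of inscribed polygons over all partitions a = t 0 <= ... <= t n = b.  It is
   infinite for non-rectifiable curves, and arcs traced repeatedly are counted repeatedly. *)
definition curve_length :: "(real \<Rightarrow> 'a::metric_space) \<Rightarrow> real \<Rightarrow> real \<Rightarrow> ennreal" where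
  "curve_length \<gamma> a b =
     (SUP (n, t) \<in> {(n::nat, t::nat \<Rightarrow> real). mono_on {..n} t \<and> t 0 = a \<and> t n = b}.
        \<Sum>i<n. ennreal (dist (\<gamma> (t i)) (\<gamma> (t (Suc i)))))"

(* Distinct preimages are counted.  The finiteness conjunct is needed because card is 0 on
   infinite sets; in particular constant functions on infinite domains are excluded.
   For nonconstant holomorphic functions on a domain, counting with multiplicity gives the
   same notion: a root of multiplicity m splits into m simple roots for nearby values. *)
definition p_valent_on :: "nat \<Rightarrow> (complex \<Rightarrow> complex) \<Rightarrow> complex set \<Rightarrow> bool" where
  "p_valent_on p f S \<longleftrightarrow>
     f holomorphic_on S \<and> (\<forall>w. finite {z \<in> S. f z = w} \<and> card {z \<in> S. f z = w} \<le> p)"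

end

theory Submission
  imports Defs
begin

text \<open>
  Put \<open>f z = log_\<xi> (2 * z)\<close> on the unit disc. Since \<open>\<xi>\<close> is \<open>p\<close>-valent, \<open>f\<close> cannot take all of
  the \<open>p + 1\<close> values \<open>w - \<i> p \<pi> + 2 \<pi> \<i> k\<close>, \<open>k \<le> p\<close>, because they have the same exponential.
  So every point \<open>w\<close> of the plane is within distance \<open>R = \<pi> p\<close> of a value omitted by \<open>f\<close>
  (\<open>p_valent_exp_omits_nearby_value\<close>).

  A theorem of Bloch-Landau type bounds the derivative of such a function: the hyperbolic
  derivative \<open>(1 - |z|\<^sup>2) |f' z|\<close> is at most \<open>C R\<close> for an absolute constant \<open>C\<close>
  (\<open>hyperbolic_deriv_le_omitted_radius\<close>). The value of \<open>C\<close> matters, since for \<open>p = 1\<close> the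
  final estimate leaves little room, and the easily proved lower bound \<open>1/12\<close> for Bloch's constant,
  which amounts to \<open>C = 12\<close>, would not do.
  The proof moves the maximum \<open>M\<close> of the hyperbolic derivative to the origin by a Moebius map.
  Integrating the bound \<open>M / (1 - |z|\<^sup>2)\<close> then gives \<open>|f z - f 0| \<le> M artanh |z|\<close>. If \<open>b\<close> is an
  omitted value with \<open>|f 0 - b| = d \<le> R\<close>, the function \<open>f - b\<close> has a holomorphic square root \<open>g\<close>,
  and the growth bound for \<open>f\<close> becomes \<open>|g|\<^sup>2 < d + M artanh r\<close> on the disc of radius \<open>r\<close>. The
  Schwarz-Pick inequality for \<open>g\<close> at the origin involves \<open>|g' 0| = M / (2 sqrt d)\<close>, and so it
  limits \<open>M\<close>: it gives \<open>M \<le> 4 d artanh r / r\<^sup>2\<close>. The choice \<open>r = 4/5\<close> is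
  close to optimal, has \<open>artanh r = ln 3\<close>, and leads to \<open>C = 25/4 * ln 3\<close>.

  Finally the interval \<open>[-1, 1]\<close> becomes \<open>[-1/2, 1/2]\<close> for \<open>f\<close>, and integration of
  \<open>C R / (1 - x\<^sup>2)\<close> over it gives length at most \<open>2 C R artanh (1/2) = 25/4 * (ln 3)\<^sup>2 * \<pi> p\<close>.
  As \<open>(ln 3)\<^sup>2 \<le> 32/25\<close>, this is at most \<open>8 \<pi> p \<le> 8 \<pi> p\<^sup>2\<close>.
\<close>

section \<open>Moebius maps and the Schwarz-Pick inequality\<close>

lemma Moebius_denominator_nonzero:
  fixes w z :: complex
  assumes "norm w < 1" "norm z < 1"
  shows "1 - cnj w * z \<noteq> 0"
proof -
  have "norm (cnj w * z) < 1"
    using norm_mult_less[of "cnj w" 1 z 1] assms by simp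
  thus ?thesis by auto
qed

lemma has_field_derivative_Moebius:
  assumes "norm w < 1" "norm z < 1"
  shows "(Moebius_function 0 w has_field_derivative
            of_real (1 - (norm w)\<^sup>2) / (1 - cnj w * z)\<^sup>2) (at z)"
proof -
  have nz: "1 - cnj w * z \<noteq> 0"
    by (rule Moebius_denominator_nonzero[OF assms])
  have sq: "of_real ((norm w)\<^sup>2) = w * cnj w"
    by (simp only: complex_norm_square)
  have "((\<lambda>z. (z - w) / (1 - cnj w * z)) has_field_derivative
          (1 * (1 - cnj w * z) - (z - w) * (- cnj w)) / (1 - cnj w * z)\<^sup>2) (at z)"
    using nz by (auto intro!: derivative_eq_intros simp: power2_eq_square)
  also have "1 * (1 - cnj w * z) - (z - w) * (- cnj w) = of_real (1 - (norm w)\<^sup>2)"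
    unfolding of_real_diff sq by (simp add: algebra_simps)
  finally show ?thesis
    by (simp add: Moebius_function_simple[abs_def])
qed

text \<open>
  This identity makes the hyperbolic derivative \<open>(1 - |z|\<^sup>2) |f' z|\<close> invariant under composition
  of \<open>f\<close> with disc automorphisms. It comes from
  \<open>|1 - cnj w z|\<^sup>2 - |z - w|\<^sup>2 = (1 - |w|\<^sup>2) (1 - |z|\<^sup>2)\<close>.
\<close>

lemma Moebius_hyperbolic_isometry:
  assumes "norm w < 1" "norm z < 1"
  shows "(1 - (norm z)\<^sup>2) * norm (deriv (Moebius_function 0 w) z)
           = 1 - (norm (Moebius_function 0 w z))\<^sup>2"
proof -
  have nz: "norm (1 - cnj w * z) \<noteq> 0"
    using Moebius_denominator_nonzero[OF assms] by simp
  have wpos: "1 - (norm w)\<^sup>2 \<ge> 0"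
    using assms by (simp add: abs_square_le_1)
  have "complex_of_real ((norm (1 - cnj w * z))\<^sup>2 - (norm (z - w))\<^sup>2)
          = of_real ((1 - (norm w)\<^sup>2) * (1 - (norm z)\<^sup>2))"
    unfolding of_real_diff of_real_mult complex_norm_square by (simp add: algebra_simps)
  hence id: "(norm (1 - cnj w * z))\<^sup>2 - (norm (z - w))\<^sup>2 = (1 - (norm w)\<^sup>2) * (1 - (norm z)\<^sup>2)"
    by (simp only: of_real_eq_iff)
  have "norm (deriv (Moebius_function 0 w) z) = (1 - (norm w)\<^sup>2) / (norm (1 - cnj w * z))\<^sup>2"
    using DERIV_imp_deriv[OF has_field_derivative_Moebius[OF assms]] wpos
    by (simp only: norm_divide norm_power norm_of_real abs_of_nonneg)
  moreover have norm_M: "(norm (Moebius_function 0 w z))\<^sup>2 = (norm (z - w))\<^sup>2 / (norm (1 - cnj w * z))\<^sup>2"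
    by (simp add: Moebius_function_simple norm_divide power_divide)
  ultimately have "(1 - (norm z)\<^sup>2) * norm (deriv (Moebius_function 0 w) z)
      = ((norm (1 - cnj w * z))\<^sup>2 - (norm (z - w))\<^sup>2) / (norm (1 - cnj w * z))\<^sup>2"
    by (simp only: id times_divide_eq_right mult.commute[of "1 - (norm w)\<^sup>2"])
  also have "\<dots> = 1 - (norm (Moebius_function 0 w z))\<^sup>2"
    using nz by (simp only: norm_M diff_divide_distrib) simp
  finally show ?thesis .
qed

text \<open>
  The Schwarz lemma applies to \<open>m \<circ> g\<close>, where the automorphism \<open>m\<close> sends \<open>g 0\<close> to \<open>0\<close>. The
  hyperbolic isometry property at \<open>g 0\<close> says that \<open>|m' (g 0)|\<close> is the reciprocal of
  \<open>1 - |g 0|\<^sup>2\<close>.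
\<close>

lemma Schwarz_Pick_deriv_0:
  assumes hol: "g holomorphic_on ball 0 1"
    and lt1: "\<And>z. norm z < 1 \<Longrightarrow> norm (g z) < 1"
  shows "norm (deriv g 0) \<le> 1 - (norm (g 0))\<^sup>2"
proof -
  define a where "a = g 0"
  define m where "m = Moebius_function 0 a"
  have a: "norm a < 1" using lt1[of 0] by (simp add: a_def)
  have "m holomorphic_on ball 0 1" unfolding m_def
    by (rule Moebius_function_holomorphic[OF a])
  hence hol': "(m \<circ> g) holomorphic_on ball 0 1"
    by (rule holomorphic_on_compose_gen[OF hol]) (use lt1 in auto)
  have "norm (deriv (m \<circ> g) 0) \<le> 1"
  proof (rule Schwarz_Lemma(2)[OF hol'])
    show "(m \<circ> g) 0 = 0" by (simp add: m_def a_def Moebius_function_eq_zero)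
    show "norm ((m \<circ> g) z) < 1" if "norm z < 1" for z
      using Moebius_function_norm_lt_1[OF a lt1[OF that]] by (simp add: m_def)
    show "norm (0::complex) < 1" by simp
  qed
  moreover have "deriv (m \<circ> g) 0 = deriv m a * deriv g 0"
    unfolding a_def
  proof (rule deriv_chain)
    show "g field_differentiable at 0"
      using hol by (rule holomorphic_on_imp_differentiable_at) auto
    show "m field_differentiable at (g 0)"
      using \<open>m holomorphic_on ball 0 1\<close> lt1[of 0]
      by (intro holomorphic_on_imp_differentiable_at[of m "ball 0 1"]) auto
  qed
  ultimately have le: "norm (deriv m a) * norm (deriv g 0) \<le> 1"
    by (simp add: norm_mult)
  have iso: "(1 - (norm a)\<^sup>2) * norm (deriv m a) = 1"
    using Moebius_hyperbolic_isometry[OF a a] by (simp add: m_def Moebius_function_eq_zero)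
  have pos: "1 - (norm a)\<^sup>2 \<ge> 0"
    using a by (simp add: abs_square_le_1)
  have "norm (deriv g 0) = (1 - (norm a)\<^sup>2) * (norm (deriv m a) * norm (deriv g 0))"
    using iso by (simp add: mult.assoc[symmetric])
  also have "\<dots> \<le> 1 - (norm a)\<^sup>2"
    using mult_left_mono[OF le pos] by simp
  finally show ?thesis by (simp add: a_def)
qed

section \<open>Derivative bounds from omitted values\<close>

text \<open>
  The real function \<open>artanh\<close> is the primitive of \<open>1 / (1 - x\<^sup>2)\<close>, so this is the mean value
  inequality along a diameter. It serves twice: for the growth of \<open>f\<close> away from the origin, and
  for the length of the image of a segment.
\<close>

lemma dist_le_artanh_diff:
  fixes f :: "complex \<Rightarrow> complex"
  assumes hol: "f holomorphic_on ball 0 1"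
    and bnd: "\<And>z. norm z < 1 \<Longrightarrow> (1 - (norm z)\<^sup>2) * norm (deriv f z) \<le> M"
    and u: "norm u = 1" and st: "-1 < s" "s \<le> t" "t < 1"
  shows "dist (f (of_real s * u)) (f (of_real t * u)) \<le> M * artanh t - M * artanh s"
proof (cases "s = t")
  case False
  hence "s < t" using st by simp
  have in_disc: "norm (of_real x * u) < 1" if "s \<le> x" "x \<le> t" for x
    using that u st by (simp add: norm_mult)
  have dv: "((\<lambda>x. f (of_real x * u)) has_vector_derivative (u * deriv f (of_real x * u))) (at x)"
    if "s \<le> x" "x \<le> t" for x
  proof -
    have "(f has_field_derivative deriv f (of_real x * u)) (at (of_real x * u))"
      using hol by (rule holomorphic_derivI) (use in_disc[OF that] in auto)
    moreover have "((\<lambda>x. of_real x * u) has_vector_derivative u) (at x)"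
      by (auto intro!: derivative_eq_intros simp: has_vector_derivative_def scaleR_conv_of_real)
    ultimately show ?thesis
      using field_vector_diff_chain_at[of "\<lambda>x. of_real x * u" u x f]
      by (simp add: o_def)
  qed
  have "norm (f (of_real t * u) - f (of_real s * u)) \<le> M * artanh t - M * artanh s"
  proof (rule differentiable_bound_general[OF \<open>s < t\<close>, where f = "\<lambda>x. f (of_real x * u)"
            and f' = "\<lambda>x. u * deriv f (of_real x * u)" and \<phi> = "\<lambda>x. M * artanh x"
            and \<phi>' = "\<lambda>x. M * (1 / (1 - x\<^sup>2))"])
    show "continuous_on {s..t} (\<lambda>x. f (of_real x * u))"
      using dv by (intro continuous_at_imp_continuous_on ballI)
                  (auto dest!: has_vector_derivative_continuous)
    show "continuous_on {s..t} (\<lambda>x. M * artanh x)"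
      using st by (auto intro!: continuous_intros)
  next
    fix x assume x: "s < x" "x < t"
    show "((\<lambda>x. f (of_real x * u)) has_vector_derivative u * deriv f (of_real x * u)) (at x)"
      using dv x by auto
    have "\<bar>x\<bar> < 1" using x st by auto
    show "((\<lambda>x. M * artanh x) has_vector_derivative M * (1 / (1 - x\<^sup>2))) (at x)"
      unfolding has_real_derivative_iff_has_vector_derivative[symmetric]
      by (rule DERIV_cmult[OF artanh_real_has_field_derivative[OF \<open>\<bar>x\<bar> < 1\<close>]])
    have "1 - x\<^sup>2 > 0" using \<open>\<bar>x\<bar> < 1\<close> by (simp add: abs_square_less_1)
    thus "norm (u * deriv f (of_real x * u)) \<le> M * (1 / (1 - x\<^sup>2))"
      using bnd[OF in_disc[of x]] x u by (simp add: norm_mult field_simps)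
  qed
  thus ?thesis by (simp add: dist_norm norm_minus_commute)
qed auto

lemma artanh_four_fifths: "artanh (4/5 :: real) = ln 3"
proof -
  have "ln (9::real) = 2 * ln 3"
    using ln_realpow[of 3 2] by simp
  thus ?thesis by (simp add: artanh_def)
qed

text \<open>
  The extremal case of the Landau-type estimate. The growth bound for \<open>f\<close> controls \<open>f - b\<close> by
  the first power of \<open>M\<close>, hence its square root \<open>g\<close> by \<open>sqrt M\<close>, whereas \<open>g' 0\<close> is proportional to
  \<open>M\<close>. Therefore the Schwarz-Pick inequality cannot hold for large \<open>M\<close>.
\<close>

lemma deriv_0_le_distance_to_omitted_value:
  fixes f :: "complex \<Rightarrow> complex"
  assumes hol: "f holomorphic_on ball 0 1"
    and bnd: "\<And>z. norm z < 1 \<Longrightarrow> (1 - (norm z)\<^sup>2) * norm (deriv f z) \<le> M"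
    and attained: "norm (deriv f 0) = M"
    and omit: "b \<notin> f ` ball 0 1"
  shows "M \<le> 25/4 * ln 3 * dist (f 0) b"
proof (cases "M = 0")
  case False
  hence M: "M > 0" using attained by auto
  obtain g where holg: "g holomorphic_on ball 0 1"
    and g: "\<And>z. z \<in> ball 0 1 \<Longrightarrow> f z - b = g z ^ 2"
  proof (rule contractible_imp_holomorphic_sqrt[of "\<lambda>z. f z - b" "ball 0 1"])
    show "(\<lambda>z. f z - b) holomorphic_on ball 0 1"
      by (intro holomorphic_intros hol)
    show "contractible (ball (0::complex) 1)"
      by (simp add: convex_imp_contractible)
    show "f z - b \<noteq> 0" if "z \<in> ball 0 1" for z
      using omit that by auto
  qed blast
  define d where "d = dist (f 0) b"
  have g0: "(norm (g 0))\<^sup>2 = d"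
    using g[of 0] by (simp add: d_def dist_norm norm_power)
  have "f 0 \<noteq> b" using omit by auto
  hence d: "d > 0" by (simp add: d_def)
  define T where "T = artanh (4/5::real)"
  define G where "G = sqrt (d + M * T)"
  have T: "T > 0" by (simp add: T_def artanh_four_fifths)
  have dMT: "d + M * T > 0" using d M T by (simp add: add_pos_pos)
  hence G: "G > 0" by (simp add: G_def)
  have G2: "G\<^sup>2 = d + M * T" using dMT by (simp add: G_def)

  \<comment> \<open>\<open>artanh (4/5) = ln 9 / 2\<close>, and \<open>(1 + x) / (1 - x)\<close> stays below 9 before that point.\<close>
  have mono: "artanh x < T" if "0 \<le> x" "x < 4/5" for x :: real
  proof -
    have "(1 + x) / (1 - x) < 9"
      using that by (simp add: field_simps)
    moreover have "(1 + x) / (1 - x) > 0" using that by simp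
    ultimately show ?thesis by (simp add: T_def artanh_def)
  qed
  have small: "norm (g z) < G" if z: "norm z < 4/5" for z
  proof -
    define u where "u = (if z = 0 then 1 else z / of_real (norm z))"
    have u: "norm u = 1" "of_real (norm z) * u = z"
      by (auto simp: u_def norm_divide)
    have "dist (f (of_real 0 * u)) (f (of_real (norm z) * u)) \<le> M * artanh (norm z) - M * artanh 0"
      by (rule dist_le_artanh_diff[OF hol bnd u(1)]) (use z in auto)
    hence "dist (f 0) (f z) \<le> M * artanh (norm z)" by (simp add: u)
    also have "\<dots> < M * T" using M mono[OF norm_ge_zero z] by simp
    finally have "norm (f z - b) < d + M * T"
      using dist_triangle[of "f z" b "f 0"] by (simp add: d_def dist_norm norm_minus_commute)
    hence "(norm (g z))\<^sup>2 < G\<^sup>2"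
      using g[of z] z by (simp add: G2 norm_power)
    thus ?thesis using G by (simp add: power2_less_imp_less)
  qed

  \<comment> \<open>Rescale the disc of radius 4/5, where \<open>|g| < G\<close>, to a self-map of the unit disc.\<close>
  define h where "h = (\<lambda>z. g (4/5 * z) / of_real G)"
  have "norm (deriv h 0) \<le> 1 - (norm (h 0))\<^sup>2"
  proof (rule Schwarz_Pick_deriv_0)
    have "g \<circ> (\<lambda>z. 4/5 * z) holomorphic_on ball 0 1"
      by (intro holomorphic_on_compose_gen[OF _ holg] holomorphic_intros) (auto simp: norm_mult)
    thus "h holomorphic_on ball 0 1"
      unfolding h_def o_def using G by (intro holomorphic_intros) auto
    show "norm (h z) < 1" if "norm z < 1" for z
      using small[of "4/5 * z"] that G by (simp add: h_def norm_mult norm_divide)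
  qed
  moreover have dg: "(g has_field_derivative deriv g 0) (at 0)"
    using holg by (rule holomorphic_derivI) auto
  have "((\<lambda>z. g (4/5 * z)) has_field_derivative deriv g 0 * (4/5)) (at 0)"
    by (rule DERIV_chain2[of g]) (use dg in \<open>auto intro!: derivative_eq_intros\<close>)
  hence "(h has_field_derivative deriv g 0 * (4/5) / of_real G) (at 0)"
    unfolding h_def by (rule DERIV_cdivide)
  hence "deriv h 0 = deriv g 0 * (4/5) / of_real G"
    by (rule DERIV_imp_deriv)
  moreover have "(norm (h 0))\<^sup>2 = d / G\<^sup>2"
    using G by (simp add: h_def norm_divide power_divide g0)
  ultimately have SP: "4/5 * norm (deriv g 0) / G \<le> 1 - d / G\<^sup>2"
    using G by (simp add: norm_mult norm_divide)
  have "deriv f 0 = 2 * g 0 * deriv g 0"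
  proof -
    have "((\<lambda>z. b + g z ^ 2) has_field_derivative 2 * g 0 * deriv g 0) (at 0)"
      using dg by (auto intro!: derivative_eq_intros)
    hence "(f has_field_derivative 2 * g 0 * deriv g 0) (at 0)"
      by (rule has_field_derivative_transform_within_open[of _ _ _ "ball 0 1"])
         (auto simp: g[symmetric])
    thus ?thesis by (rule DERIV_imp_deriv)
  qed
  hence "M = 2 * norm (g 0) * norm (deriv g 0)"
    using attained by (simp add: norm_mult)
  hence "M\<^sup>2 = 4 * d * (norm (deriv g 0))\<^sup>2"
    by (simp add: power_mult_distrib g0)
  moreover have "norm (deriv g 0) * (4/5 * G) \<le> M * T"
  proof -
    have "4/5 * norm (deriv g 0) / G * G\<^sup>2 \<le> (1 - d / G\<^sup>2) * G\<^sup>2"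
      by (rule mult_right_mono[OF SP]) simp
    also have "\<dots> = M * T" using G by (simp add: left_diff_distrib) (simp add: G2)
    finally show ?thesis using G by (simp add: power2_eq_square mult_ac)
  qed
  hence "(norm (deriv g 0) * (4/5 * G))\<^sup>2 \<le> (M * T)\<^sup>2"
    using G by (intro power_mono) auto
  hence "(norm (deriv g 0))\<^sup>2 * (16/25 * G\<^sup>2) \<le> (M * T)\<^sup>2"
    by (simp only: power_mult_distrib) (simp add: power_divide)
  ultimately have "M\<^sup>2 * (16/25 * G\<^sup>2) \<le> 4 * d * (M * T)\<^sup>2"
    using d mult_left_mono[of "(norm (deriv g 0))\<^sup>2 * (16/25 * G\<^sup>2)" "(M * T)\<^sup>2" "4 * d"]
    by (simp add: mult_ac)
  hence "16/25 * G\<^sup>2 \<le> 4 * d * T\<^sup>2"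
    using M by (simp add: power_mult_distrib)
  hence "16/25 * (d + M * T) \<le> 4 * d * T\<^sup>2"
    by (simp only: G2)
  hence "M * T \<le> (25/4 * d * T) * T"
    using d by (simp add: power2_eq_square algebra_simps)
  hence "M \<le> 25/4 * d * T"
    using T by (simp only: mult_le_cancel_right_pos)
  thus ?thesis by (simp add: T_def d_def artanh_four_fifths mult_ac)
qed auto


text \<open>
  Holomorphy beyond the closed unit disc ensures that the hyperbolic derivative attains its
  maximum: it vanishes on the unit circle, so unless it is identically zero the maximum is at an
  interior point \<open>a\<close>. Composition with the automorphism taking \<open>0\<close> to \<open>a\<close> does not change the set
  of values and reduces to the case of a maximum at the origin.
\<close>

lemma hyperbolic_deriv_le_omitted_radius_larger_disc:
  fixes f :: "complex \<Rightarrow> complex"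
  assumes hol: "f holomorphic_on ball 0 r" and r: "r > 1"
    and omit: "\<And>w. \<exists>b. b \<notin> f ` ball 0 1 \<and> dist w b \<le> R"
    and z: "norm z < 1"
  shows "(1 - (norm z)\<^sup>2) * norm (deriv f z) \<le> 25/4 * ln 3 * R"
proof -
  define Q where "Q = (\<lambda>z. (1 - (norm z)\<^sup>2) * norm (deriv f z))"
  have "deriv f holomorphic_on ball 0 r"
    using hol by (rule holomorphic_deriv) auto
  hence "continuous_on (cball 0 1) (deriv f)"
    using r by (intro holomorphic_on_imp_continuous_on) (auto elim!: holomorphic_on_subset)
  hence "continuous_on (cball 0 1) Q"
    unfolding Q_def by (intro continuous_intros)
  moreover have "compact (cball (0::complex) 1)" "cball (0::complex) 1 \<noteq> {}" by auto
  ultimately obtain a where a: "a \<in> cball 0 1" and max: "\<And>y. y \<in> cball 0 1 \<Longrightarrow> Q y \<le> Q a"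
    using continuous_attains_sup by metis
  have R: "R \<ge> 0" using omit[of 0] by (meson order_trans zero_le_dist)
  have "Q a \<le> 25/4 * ln 3 * R"
  proof (cases "norm a = 1")
    case True
    thus ?thesis using R by (simp add: Q_def)
  next
    case False
    hence a1: "norm (-a) < 1" using a by simp
    define m where "m = Moebius_function 0 (-a)"
    have m0: "m 0 = a" by (simp add: m_def Moebius_function_of_zero)
    have m1: "norm (m y) < 1" if "norm y < 1" for y
      unfolding m_def by (rule Moebius_function_norm_lt_1[OF a1 that])
    have holm: "m holomorphic_on ball 0 1"
      unfolding m_def by (rule Moebius_function_holomorphic[OF a1])
    have hol1: "f holomorphic_on ball 0 1"
      using hol r by (auto elim!: holomorphic_on_subset)
    define F where "F = f \<circ> m"
    have holF: "F holomorphic_on ball 0 1"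
      unfolding F_def by (rule holomorphic_on_compose_gen[OF holm hol1]) (use m1 in auto)
    have QF: "(1 - (norm y)\<^sup>2) * norm (deriv F y) = Q (m y)" if y: "norm y < 1" for y
    proof -
      have "deriv F y = deriv f (m y) * deriv m y"
        unfolding F_def
      proof (rule deriv_chain)
        show "m field_differentiable at y"
          using holm y by (intro holomorphic_on_imp_differentiable_at[of m "ball 0 1"]) auto
        show "f field_differentiable at (m y)"
          using hol1 m1[OF y] by (intro holomorphic_on_imp_differentiable_at[of f "ball 0 1"]) auto
      qed
      thus ?thesis
        using Moebius_hyperbolic_isometry[OF a1 y] by (simp add: Q_def m_def norm_mult)
    qed
    obtain b where b: "b \<notin> f ` ball 0 1" "dist (F 0) b \<le> R" using omit by blast
    have "Q a \<le> 25/4 * ln 3 * dist (F 0) b"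
    proof (rule deriv_0_le_distance_to_omitted_value[OF holF])
      show "(1 - (norm y)\<^sup>2) * norm (deriv F y) \<le> Q a" if "norm y < 1" for y
        unfolding QF[OF that] using m1[OF that] by (intro max) auto
      show "norm (deriv F 0) = Q a"
        using QF[of 0] by (simp add: m0)
      show "b \<notin> F ` ball 0 1"
        using b(1) m1 by (auto simp: F_def)
    qed
    also have "\<dots> \<le> 25/4 * ln 3 * R"
      using b(2) by (intro mult_left_mono) auto
    finally show ?thesis .
  qed
  moreover have "Q z \<le> Q a" using z by (intro max) auto
  ultimately show ?thesis by (simp add: Q_def)
qed

text \<open>
  Apply the previous estimate to the dilations \<open>f (\<rho> y)\<close>, which omit at least the values that \<open>f\<close>
  omits, and let \<open>\<rho>\<close> tend to 1 from below.
\<close>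

lemma hyperbolic_deriv_le_omitted_radius:
  fixes f :: "complex \<Rightarrow> complex"
  assumes hol: "f holomorphic_on ball 0 1"
    and omit: "\<And>w. \<exists>b. b \<notin> f ` ball 0 1 \<and> dist w b \<le> R"
    and z: "norm z < 1"
  shows "(1 - (norm z)\<^sup>2) * norm (deriv f z) \<le> 25/4 * ln 3 * R"
proof -
  have dil: "(1 - (norm z)\<^sup>2) * norm (of_real \<rho> * deriv f (of_real \<rho> * z)) \<le> 25/4 * ln 3 * R"
    if \<rho>: "0 < \<rho>" "\<rho> < 1" for \<rho> :: real
  proof -
    define g where "g = (\<lambda>y. f (of_real \<rho> * y))"
    have "f \<circ> (\<lambda>y. of_real \<rho> * y) holomorphic_on ball 0 (1 / \<rho>)"
      using \<rho> by (intro holomorphic_on_compose_gen[OF _ hol] holomorphic_intros)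
                 (auto simp: norm_mult field_simps)
    hence holg: "g holomorphic_on ball 0 (1 / \<rho>)" by (simp add: g_def o_def)
    have sub: "of_real \<rho> * y \<in> ball 0 1" if "y \<in> ball 0 1" for y :: complex
      using that \<rho> mult_strict_mono[of \<rho> 1 "norm y" 1] by (simp add: norm_mult)
    hence "g ` ball 0 1 \<subseteq> f ` ball 0 1" by (auto simp: g_def)
    hence "\<exists>b. b \<notin> g ` ball 0 1 \<and> dist w b \<le> R" for w
      using omit[of w] by blast
    hence "(1 - (norm z)\<^sup>2) * norm (deriv g z) \<le> 25/4 * ln 3 * R"
      using \<rho> by (intro hyperbolic_deriv_le_omitted_radius_larger_disc[OF holg _ _ z]) auto
    moreover have "(f has_field_derivative deriv f (of_real \<rho> * z)) (at (of_real \<rho> * z))"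
      using hol by (rule holomorphic_derivI) (use sub[of z] z in auto)
    hence "(g has_field_derivative deriv f (of_real \<rho> * z) * of_real \<rho>) (at z)"
      unfolding g_def by (rule DERIV_chain2) (auto intro!: derivative_eq_intros)
    ultimately show ?thesis by (simp add: DERIV_imp_deriv mult.commute)
  qed
  have cont: "isCont (deriv f) z"
    using holomorphic_deriv[OF hol] z
    by (auto dest!: holomorphic_on_imp_continuous_on simp: continuous_on_eq_continuous_at)
  have "((\<lambda>\<rho>. of_real \<rho> * z) \<longlongrightarrow> of_real 1 * z) (at_left 1)"
    by (intro tendsto_intros)
  hence lim: "((\<lambda>\<rho>. of_real \<rho> * z) \<longlongrightarrow> z) (at_left 1)" by simp
  have "((\<lambda>\<rho>. (1 - (norm z)\<^sup>2) * norm (of_real \<rho> * deriv f (of_real \<rho> * z)))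
          \<longlongrightarrow> (1 - (norm z)\<^sup>2) * norm (of_real 1 * deriv f z)) (at_left 1)"
    by (intro tendsto_intros isCont_tendsto_compose[OF cont] lim)
  moreover have "eventually (\<lambda>\<rho>::real. \<rho> \<in> {0<..<1}) (at_left 1)"
    by (rule eventually_at_left_real) simp
  hence "eventually (\<lambda>\<rho>. (1 - (norm z)\<^sup>2) * norm (of_real \<rho> * deriv f (of_real \<rho> * z))
            \<le> 25/4 * ln 3 * R) (at_left 1)"
    by eventually_elim (use dil in auto)
  ultimately show ?thesis
    using tendsto_upperbound[of _ _ "at_left (1::real)"] by (fastforce simp: trivial_limit_at_left_real)
qed

section \<open>Logarithms of p-valent functions and the length estimate\<close>

text \<open>
  The candidates are \<open>p + 1\<close> points on the vertical line through \<open>w\<close> with spacing \<open>2 \<pi>\<close>, placed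
  symmetrically about \<open>w\<close>. If all of them were values of \<open>f\<close>, their common exponential would be
  taken by \<open>\<xi>\<close> at \<open>p + 1\<close> different points.
\<close>

lemma p_valent_exp_omits_nearby_value:
  assumes val: "p_valent_on p \<xi> S"
    and log: "\<And>z. z \<in> S \<Longrightarrow> exp (f z) = \<xi> z"
  shows "\<exists>b. b \<notin> f ` S \<and> dist w b \<le> pi * real p"
proof (rule ccontr)
  define b where "b k = w + \<i> * of_real (pi * (2 * real k - real p))" for k :: nat
  assume contra: "\<not> ?thesis"
  have "dist w (b k) \<le> pi * real p" if "k \<le> p" for k
  proof -
    have "dist w (b k) = pi * \<bar>2 * real k - real p\<bar>"
      unfolding b_def dist_norm by (simp add: norm_mult abs_mult del: of_real_mult of_real_diff)
    also have "\<dots> \<le> pi * real p"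
      using that by (intro mult_left_mono) auto
    finally show ?thesis .
  qed
  hence "\<forall>k\<in>{..p}. \<exists>z\<in>S. f z = b k"
    using contra by (metis atMost_iff imageE)
  then obtain \<zeta> where \<zeta>: "\<And>k. k \<le> p \<Longrightarrow> \<zeta> k \<in> S \<and> f (\<zeta> k) = b k"
    by (metis atMost_iff)
  have inj: "inj_on \<zeta> {..p}"
  proof (rule inj_onI)
    fix j k assume "j \<in> {..p}" "k \<in> {..p}" "\<zeta> j = \<zeta> k"
    hence "b j = b k" using \<zeta>[of j] \<zeta>[of k] by simp
    thus "j = k" by (simp add: b_def del: of_real_mult of_real_diff)
  qed
  have exp_b: "exp (b k) = exp (b 0)" for k
    unfolding exp_eq b_def by (rule exI[of _ "int k"]) (simp add: algebra_simps)
  define V where "V = {z \<in> S. \<xi> z = exp (b 0)}"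
  have "\<zeta> ` {..p} \<subseteq> V"
  proof (rule image_subsetI)
    fix k assume "k \<in> {..p}"
    hence "\<zeta> k \<in> S" "f (\<zeta> k) = b k" using \<zeta>[of k] by auto
    thus "\<zeta> k \<in> V" using exp_b[of k] log[of "\<zeta> k"] by (simp add: V_def)
  qed
  moreover have "finite V" "card V \<le> p"
    using val by (auto simp: p_valent_on_def V_def)
  ultimately have "card (\<zeta> ` {..p}) \<le> p"
    using card_mono order_trans by metis
  thus False using card_image[OF inj] by simp
qed

lemma curve_length_le_diff:
  fixes \<phi> :: "real \<Rightarrow> real"
  assumes bnd: "\<And>s t. a \<le> s \<Longrightarrow> s \<le> t \<Longrightarrow> t \<le> b \<Longrightarrow> dist (\<gamma> s) (\<gamma> t) \<le> \<phi> t - \<phi> s"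
  shows "curve_length \<gamma> a b \<le> ennreal (\<phi> b - \<phi> a)"
  unfolding curve_length_def
proof (rule SUP_least, clarify)
  fix n :: nat and t :: "nat \<Rightarrow> real"
  assume mono: "mono_on {..n} t" and a: "a = t 0" and b: "b = t n"
  have "(\<Sum>i<n. ennreal (dist (\<gamma> (t i)) (\<gamma> (t (Suc i)))))
          = ennreal (\<Sum>i<n. dist (\<gamma> (t i)) (\<gamma> (t (Suc i))))"
    by (rule sum_ennreal) simp
  also have "(\<Sum>i<n. dist (\<gamma> (t i)) (\<gamma> (t (Suc i)))) \<le> (\<Sum>i<n. \<phi> (t (Suc i)) - \<phi> (t i))"
  proof (rule sum_mono)
    fix i assume "i \<in> {..<n}"
    thus "dist (\<gamma> (t i)) (\<gamma> (t (Suc i))) \<le> \<phi> (t (Suc i)) - \<phi> (t i)"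
      unfolding a b by (intro bnd) (auto simp: a b intro!: mono_onD[OF mono])
  qed
  also have "\<dots> = \<phi> (t n) - \<phi> (t 0)" by (rule sum_lessThan_telescope)
  finally show "(\<Sum>i<n. ennreal (dist (\<gamma> (t i)) (\<gamma> (t (Suc i))))) \<le> ennreal (\<phi> (t n) - \<phi> (t 0))"
    by (simp add: ennreal_leI)
qed

text \<open>
  The intermediate bound \<open>ln 3 \<le> 9/8\<close> follows from the quadratic Taylor bound for \<open>exp\<close> at
  \<open>9/32\<close>, raised to the fourth power.
\<close>

lemma ln_3_squared_le: "(ln 3 :: real)\<^sup>2 \<le> 32/25"
proof -
  have "(3::real) \<le> (1 + 9/32 + (9/32)\<^sup>2 / 2) ^ 4"
    by (simp add: power_divide)
  also have "\<dots> \<le> exp (9/32) ^ 4"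
    by (intro power_mono exp_lower_Taylor_quadratic) auto
  also have "\<dots> = exp (9/8)"
    using exp_of_nat_mult[of 4 "9/32 :: real"] by simp
  finally have "ln (3::real) \<le> ln (exp (9/8))"
    by (subst ln_le_cancel_iff) auto
  hence "ln (3::real) \<le> 9/8" by simp
  hence "(ln 3 :: real)\<^sup>2 \<le> (9/8)\<^sup>2"
    by (intro power_mono) auto
  also have "\<dots> \<le> 32/25" by (simp add: power2_eq_square)
  finally show ?thesis .
qed

theorem lemma3:
  fixes \<xi> log_\<xi> :: "complex \<Rightarrow> complex" and p :: nat
  assumes "\<xi> holomorphic_on ball 0 2"
    and "\<And>z. z \<in> ball 0 2 \<Longrightarrow> \<xi> z \<noteq> 0"
    and "p_valent_on p \<xi> (ball 0 2)"
    and "log_\<xi> holomorphic_on ball 0 2"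
    and "\<And>z. z \<in> ball 0 2 \<Longrightarrow> exp (log_\<xi> z) = \<xi> z"
  shows "curve_length (\<lambda>t. log_\<xi> (of_real t)) (-1) 1 \<le> ennreal (8 * pi * (real p)\<^sup>2)"
proof -
  define f where "f = (\<lambda>z. log_\<xi> (2 * z))"
  define M where "M = 25/4 * ln 3 * (pi * real p)"
  have "log_\<xi> \<circ> (\<lambda>z. 2 * z) holomorphic_on ball 0 1"
    by (intro holomorphic_on_compose_gen[OF _ assms(4)] holomorphic_intros) (auto simp: norm_mult)
  hence holf: "f holomorphic_on ball 0 1" by (simp add: f_def o_def)
  have "f ` ball 0 1 \<subseteq> log_\<xi> ` ball 0 2"
    by (auto simp: f_def norm_mult)
  hence "\<exists>b. b \<notin> f ` ball 0 1 \<and> dist w b \<le> pi * real p" for w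
    using p_valent_exp_omits_nearby_value[OF assms(3,5), of w] by blast
  hence bnd: "(1 - (norm z)\<^sup>2) * norm (deriv f z) \<le> M" if "norm z < 1" for z
    unfolding M_def using that by (intro hyperbolic_deriv_le_omitted_radius[OF holf])
  \<comment> \<open>The rescaled parameter interval is \<open>[-1/2, 1/2]\<close>.\<close>
  have "curve_length (\<lambda>t. log_\<xi> (of_real t)) (-1) 1 \<le> ennreal (M * artanh (1/2) - M * artanh (-1/2))"
  proof (rule curve_length_le_diff)
    fix s t :: real assume st: "-1 \<le> s" "s \<le> t" "t \<le> 1"
    show "dist (log_\<xi> (of_real s)) (log_\<xi> (of_real t)) \<le> M * artanh (t/2) - M * artanh (s/2)"
      using dist_le_artanh_diff[OF holf bnd, of 1 "s/2" "t/2"] st by (simp add: f_def)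
  qed
  also have "M * artanh (1/2) - M * artanh (-1/2) = M * ln 3"
    by (simp add: artanh_def ln_div field_simps)
  also have "\<dots> \<le> 8 * pi * (real p)\<^sup>2"
  proof -
    have "M * ln 3 = 25/4 * (ln 3)\<^sup>2 * (pi * real p)"
      by (simp add: M_def power2_eq_square)
    also have "\<dots> \<le> 8 * (pi * real p)"
      using ln_3_squared_le by (intro mult_right_mono) auto
    also have "real p \<le> (real p)\<^sup>2"
      by (cases p) (auto simp: power2_eq_square)
    hence "8 * (pi * real p) \<le> 8 * pi * (real p)\<^sup>2" by simp
    finally show ?thesis .
  qed
  finally show ?thesis by (simp add: ennreal_leI)
qed

end
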